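(* Let $\alpha\in\mathbb C$ and let $F(z)\in\mathbb C[[z]]$. The following conditions are equivalent. (i) $F$ is Möbius-covariant of weight $\alpha$, i.e. $F\!\left(-\frac{z}{1-z}\right)=(1-z)^{-\alpha}F(z)$ in $\mathbb C[[z]]$. (ii) $F$ satisfies the Möbius coefficient duality of weight $\alpha$, i.e. for every integer $r\ge 0$ and every $h\in\mathbb C[[z]]$, $$[z^r]\,h(z)F(z)=[z^r]\,h\!\left(\frac{z}{1+z}\right)(1+z)^{r-1-\alpha}F(-z).$$ (iii) For every integer $r\ge0$, the identity in (ii) holds with $h=1$, i.e. $[z^r]F(z)=[z^r](1+z)^{r-1-\alpha}F(-z)$. (iv) There exists a unique $\Phi_{F,\alpha}(t)\in\mathbb C[[t]]$ such that $$F(z)=(1-z)^{\alpha/2}\,\Phi_{F,\alpha}\!\left(\left(\frac{z}{2-z}\right)^2\right).$$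
   Context: All identities are between formal power series over $\mathbb C$. $[z^r]H(z)$ denotes the coefficient of $z^r$ in $H(z)$. For $\beta\in\mathbb C$, $(1\pm z)^\beta:=\sum_{k\ge0}\binom{\beta}{k}(\pm z)^k$ with $\binom{\beta}{k}=\beta(\beta-1)\cdots(\beta-k+1)/k!$. Rational functions such as $-z/(1-z)$, $z/(1+z)$, $z/(2-z)$ are expanded as power series in $z$ (they have zero constant term, so composition is defined). *)

theory Defs
  imports Complex_Main "HOL-Computational_Algebra.Formal_Power_Series"
begin

text \<open>
  The library's \<^const>\<open>fps_binomial\<close> is the binomial series of \<open>(1 + z)\<close> to the power \<open>\<beta>\<close>;
  the following is its counterpart for \<open>(1 - z)\<close>. Quotients such as \<open>- fps_X / (1 - fps_X)\<close>
  below have an invertible denominator, so the division of power series is the expected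
  expansion, and their constant term is zero, as required for composition.
\<close>

definition fps_binomial_minus :: "complex \<Rightarrow> complex fps" where
  "fps_binomial_minus \<beta> = Abs_fps (\<lambda>k. (\<beta> gchoose k) * (- 1) ^ k)"

definition mobius_covariant :: "complex \<Rightarrow> complex fps \<Rightarrow> bool" where
  "mobius_covariant \<alpha> F \<longleftrightarrow>
     F oo (- fps_X / (1 - fps_X)) = fps_binomial_minus (- \<alpha>) * F"

definition mobius_duality_at :: "complex \<Rightarrow> complex fps \<Rightarrow> nat \<Rightarrow> complex fps \<Rightarrow> bool" where
  "mobius_duality_at \<alpha> F r h \<longleftrightarrow>
     fps_nth (h * F) r =
     fps_nth ((h oo (fps_X / (1 + fps_X))) * fps_binomial (of_nat r - 1 - \<alpha>) * (F oo (- fps_X))) r"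

definition mobius_coefficient_duality :: "complex \<Rightarrow> complex fps \<Rightarrow> bool" where
  "mobius_coefficient_duality \<alpha> F \<longleftrightarrow> (\<forall>r h. mobius_duality_at \<alpha> F r h)"

end

theory Submission
  imports Defs
begin

text \<open>
  The substitution \<open>z = w / (1 + w)\<close> gives \<open>[z^r] G(z) = [w^r] G(w / (1 + w)) (1 + w)^(r - 1)\<close> for
  every series \<open>G\<close>. Applied to \<open>h F\<close> it turns covariance into duality. Applied to \<open>F\<close> it shows that,
  for \<open>h = 1\<close>, the defect \<open>D\<close> of covariance satisfies \<open>[w^r] D(w) (1 + w)^(r - 1) = 0\<close> for all \<open>r\<close>,
  and the lowest coefficient of \<open>D\<close> then has to vanish. For the representation, the involution
  \<open>z \<mapsto> - z / (1 - z)\<close> sends \<open>u = z / (2 - z)\<close> to \<open>- u\<close> and \<open>1 - z\<close> to its inverse, so \<open>F\<close> is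
  covariant iff \<open>(1 - z)^(- \<alpha> / 2) F\<close>, written as a series in \<open>u\<close>, is even.
\<close>

section \<open>Coefficient extraction under the substitution z / (1 + z)\<close>

lemma fps_X_div_one_plus_X_power:
  "(fps_X / (1 + fps_X)) ^ k = fps_X ^ k * fps_binomial (- of_nat k :: 'a :: field_char_0)"
proof -
  have "fps_X / (1 + fps_X :: 'a fps) = fps_X * fps_binomial (-1)"
    by (simp add: fps_divide_unit fps_binomial_minus_one)
  then show ?thesis
    by (simp add: power_mult_distrib fps_binomial_power)
qed

text \<open>By linearity only the powers of X matter: X^k becomes X^k (1 + X)^(r - 1 - k), whose
  coefficient at r is (r - 1 - k) choose (r - k). For k < r the upper entry is a natural number
  below the lower one, so this is 0.\<close>

lemma fps_nth_compose_mobius_mult_binomial: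
  fixes G :: "'a :: field_char_0 fps"
  shows "fps_nth ((G oo (fps_X / (1 + fps_X))) * fps_binomial (of_nat r - 1)) r = fps_nth G r"
proof -
  define s :: "'a fps" where "s = fps_X / (1 + fps_X)"
  define B :: "'a fps" where "B = fps_binomial (of_nat r - 1)"
  have s0: "fps_nth s 0 = 0"
    by (simp add: s_def)
  have coeff: "fps_nth (s ^ k * B) r = (if k = r then 1 else 0)" if "k \<le> r" for k
  proof -
    have "s ^ k * B = fps_X ^ k * fps_binomial (of_nat r - 1 - of_nat k)"
      by (simp add: s_def B_def fps_X_div_one_plus_X_power mult.assoc
          flip: fps_binomial_add_mult)
    then have nth: "fps_nth (s ^ k * B) r = (of_nat r - 1 - of_nat k) gchoose (r - k)"
      using that by (simp add: fps_X_power_mult_nth)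
    show ?thesis
    proof (cases "k = r")
      \<comment> \<open>For k = r the upper entry is -1, but the lower one is 0, so that case gives
        1.\<close>
      case False
      with that have "r = k + (r - k - 1) + 1"
        by simp
      then have "of_nat r - 1 - of_nat k = (of_nat (r - k - 1) :: 'a)"
        by (metis add_diff_cancel_left' add_diff_cancel_right' of_nat_1 of_nat_add)
      moreover have "(of_nat (r - k - 1) :: 'a) gchoose (r - k) = 0"
        using that False unfolding binomial_gbinomial [symmetric] by (simp add: binomial_eq_0)
      ultimately show ?thesis
        using nth False by metis
    qed (use nth in simp)
  qed
  \<comment> \<open>The inner sum is padded from i up to r, making its range independent of i so
    that the sums can be swapped; the added terms vanish as \<open>s ^ k\<close> starts in degree
    k.\<close>
  have comp: "fps_nth (G oo s) i = (\<Sum>k=0..r. fps_nth G k * fps_nth (s ^ k) i)" if "i \<le> r" for i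
    unfolding fps_compose_nth
    by (rule sum.mono_neutral_left) (use that startsby_zero_power_prefix[OF s0] in auto)
  have "fps_nth ((G oo s) * B) r
      = (\<Sum>i=0..r. (\<Sum>k=0..r. fps_nth G k * fps_nth (s ^ k) i) * fps_nth B (r - i))"
    unfolding fps_mult_nth by (intro sum.cong refl) (simp add: comp)
  also have "\<dots> = (\<Sum>k=0..r. fps_nth G k * fps_nth (s ^ k * B) r)"
    unfolding fps_mult_nth sum_distrib_left sum_distrib_right
    by (subst sum.swap) (simp add: mult.assoc)
  also have "\<dots> = (\<Sum>k=0..r. if k = r then fps_nth G k else 0)"
    by (intro sum.cong refl) (simp add: coeff)
  finally show ?thesis
    by (simp add: s_def B_def)
qed

text \<open>The factor may vary with r: taking r to be the subdegree of a nonzero \<open>D\<close>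
  exposes its lowest coefficient, multiplied by 1.\<close>

lemma fps_eq_0_if_nth_mult_eq_0:
  fixes D :: "'a :: idom fps"
  assumes "\<And>r. fps_nth (u r) 0 = 1" and "\<And>r. fps_nth (D * u r) r = 0"
  shows "D = 0"
proof (rule ccontr)
  assume "D \<noteq> 0"
  then have "fps_nth (D * u (subdegree D)) (subdegree D) \<noteq> 0"
    unfolding nth_subdegree_mult_left using assms(1) by simp
  then show False
    using assms(2) by blast
qed

section \<open>Binomial series under the Moebius substitutions\<close>

lemma fps_binomial_compose_mobius:
  "fps_binomial \<beta> oo (- fps_X / (1 + fps_X)) = fps_binomial (- \<beta> :: 'a :: field_char_0)"
proof -
  define v :: "'a fps" where "v = - fps_X / (1 + fps_X)"
  define i :: "'a fps" where "i = inverse (1 + fps_X)"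
  have i: "(1 + fps_X) * i = 1"
    by (simp add: i_def inverse_mult_eq_1')
  have v0: "fps_nth v 0 = 0"
    by (simp add: v_def)
  \<comment> \<open>The substitution thus sends 1 + X to its inverse. The claim follows because the
    composite solves (1 + X) y' = - \<beta> y with constant term 1.\<close>
  have v: "v = i - 1"
    using i by (simp add: v_def fps_divide_unit i_def algebra_simps eq_neg_iff_add_eq_0)
  have comp: "inverse (1 + fps_X) oo v = 1 + fps_X"
    using i by (simp add: fps_inverse_compose v0 fps_compose_add_distrib)
       (simp add: v i_def)
  have "fps_deriv v = - (i * i)"
    by (simp add: v i_def fps_inverse_deriv power2_eq_square)
  then have "fps_deriv (fps_binomial \<beta> oo v)
      = (fps_const \<beta> * (fps_binomial \<beta> oo v)) * (1 + fps_X) * (- (i * i))"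
    using comp v0
    by (simp add: fps_compose_deriv fps_binomial_deriv fps_divide_unit fps_compose_mult_distrib)
  also have "\<dots> = fps_const (- \<beta>) * (fps_binomial \<beta> oo v) * i * ((1 + fps_X) * i)"
    by (simp add: algebra_simps flip: fps_const_neg)
  finally have "fps_deriv (fps_binomial \<beta> oo v) = fps_const (- \<beta>) * (fps_binomial \<beta> oo v) / (1 + fps_X)"
    by (simp add: i) (simp add: fps_divide_unit i_def)
  then show ?thesis
    using fps_binomial_ODE_unique'[of "fps_binomial \<beta> oo v" "- \<beta>"] by (simp add: v_def)
qed

lemma fps_binomial_minus_conv_compose:
  "fps_binomial_minus \<beta> = fps_binomial \<beta> oo (- fps_X)"
  by (simp add: fps_eq_iff fps_binomial_minus_def fps_compose_uminus')

lemma fps_compose_uminus_X_twice: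
  "F oo (- fps_X) oo (- fps_X) = (F :: 'a :: comm_ring_1 fps)"
  by (simp add: fps_eq_iff fps_compose_uminus' flip: power_mult_distrib mult.assoc)

lemma fps_binomial_minus_add:
  "fps_binomial_minus (\<beta> + \<gamma>) = fps_binomial_minus \<beta> * fps_binomial_minus \<gamma>"
  by (simp add: fps_binomial_minus_conv_compose fps_binomial_add_mult fps_compose_mult_distrib)

lemma fps_binomial_minus_0 [simp]: "fps_binomial_minus 0 = 1"
  by (simp add: fps_binomial_minus_conv_compose)

lemma fps_binomial_minus_neq_0: "fps_binomial_minus \<beta> \<noteq> 0"
proof
  assume "fps_binomial_minus \<beta> = 0"
  then have "fps_nth (fps_binomial_minus \<beta>) 0 = 0"
    by simp
  then show False
    by (simp add: fps_binomial_minus_def)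
qed

text \<open>Conjugation by z \<mapsto> - z reduces this to
  \<open>fps_binomial_compose_mobius\<close>.\<close>

lemma fps_binomial_minus_compose_mobius:
  "fps_binomial_minus \<beta> oo (- fps_X / (1 - fps_X)) = fps_binomial_minus (- \<beta>)"
proof -
  have "(- fps_X) oo (- fps_X / (1 - fps_X)) = (- fps_X / (1 + fps_X) :: complex fps) oo (- fps_X)"
    by (simp add: fps_divide_compose fps_compose_add_distrib fps_compose_uminus)
       (simp add: fps_divide_unit)
  then show ?thesis
    by (simp add: fps_binomial_minus_conv_compose fps_compose_assoc [symmetric])
       (simp add: fps_compose_assoc fps_binomial_compose_mobius)
qed

section \<open>Covariance and coefficient duality\<close>

lemma mobius_covariant_iff_compose:
  "mobius_covariant \<alpha> F \<longleftrightarrow>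
     F oo (fps_X / (1 + fps_X)) = fps_binomial (- \<alpha>) * (F oo (- fps_X))"
proof -
  have inj: "f oo (- fps_X) = g oo (- fps_X) \<longleftrightarrow> f = g" for f g :: "complex fps"
    by (metis fps_compose_uminus_X_twice)
  have "- fps_X / (1 - fps_X) oo (- fps_X) = (fps_X / (1 + fps_X) :: complex fps)"
    by (simp add: fps_divide_compose fps_compose_sub_distrib fps_compose_uminus)
  then have "F oo (- fps_X / (1 - fps_X)) oo (- fps_X) = F oo (fps_X / (1 + fps_X))"
    by (simp add: fps_compose_assoc [symmetric])
  moreover have "fps_binomial_minus (- \<alpha>) * F oo (- fps_X) = fps_binomial (- \<alpha>) * (F oo (- fps_X))"
    by (simp add: fps_compose_mult_distrib fps_binomial_minus_conv_compose
        fps_compose_uminus_X_twice)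
  ultimately show ?thesis
    unfolding mobius_covariant_def by (metis inj)
qed

lemma mobius_covariant_imp_duality:
  assumes "mobius_covariant \<alpha> F"
  shows "mobius_coefficient_duality \<alpha> F"
  unfolding mobius_coefficient_duality_def mobius_duality_at_def
proof (intro allI)
  fix r h
  let ?s = "fps_X / (1 + fps_X) :: complex fps"
  \<comment> \<open>Covariance supplies the exponent - \<alpha>, coefficient extraction the exponent
    r - 1.\<close>
  have B: "fps_binomial (of_nat r - 1 - \<alpha>) = fps_binomial (- \<alpha>) * fps_binomial (of_nat r - 1)"
    by (simp flip: fps_binomial_add_mult)
  have "fps_nth (h * F) r = fps_nth ((h * F oo ?s) * fps_binomial (of_nat r - 1)) r"
    by (rule fps_nth_compose_mobius_mult_binomial [symmetric])
  also have "h * F oo ?s = (h oo ?s) * (fps_binomial (- \<alpha>) * (F oo (- fps_X)))"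
    using assms by (simp add: fps_compose_mult_distrib mobius_covariant_iff_compose)
  finally show "fps_nth (h * F) r =
      fps_nth ((h oo ?s) * fps_binomial (of_nat r - 1 - \<alpha>) * (F oo (- fps_X))) r"
    by (simp add: B mult_ac)
qed

lemma mobius_covariantI_coefficients:
  assumes "\<And>r. fps_nth F r = fps_nth (fps_binomial (of_nat r - 1 - \<alpha>) * (F oo (- fps_X))) r"
  shows "mobius_covariant \<alpha> F"
proof -
  define D where "D = (F oo (fps_X / (1 + fps_X))) - fps_binomial (- \<alpha>) * (F oo (- fps_X))"
  have "fps_nth (D * fps_binomial (of_nat r - 1)) r = 0" for r
  proof -
    have B: "fps_binomial (of_nat r - 1 - \<alpha>) = fps_binomial (- \<alpha>) * fps_binomial (of_nat r - 1)"
      by (simp flip: fps_binomial_add_mult)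
    have "D * fps_binomial (of_nat r - 1)
        = (F oo (fps_X / (1 + fps_X))) * fps_binomial (of_nat r - 1)
          - fps_binomial (of_nat r - 1 - \<alpha>) * (F oo (- fps_X))"
      unfolding D_def B left_diff_distrib by (simp only: mult_ac)
    then show ?thesis
      using assms[of r] by (simp add: fps_nth_compose_mobius_mult_binomial)
  qed
  then have "D = 0"
    by (rule fps_eq_0_if_nth_mult_eq_0[rotated]) simp
  then show ?thesis
    by (simp add: D_def mobius_covariant_iff_compose)
qed

section \<open>Representation by even series in z / (2 - z)\<close>

lemma fps_X_div_two_minus_X_compose_mobius:
  "fps_X / (2 - fps_X) oo (- fps_X / (1 - fps_X)) = - (fps_X / (2 - fps_X) :: complex fps)"
proof -
  define i :: "complex fps" where "i = inverse (1 - fps_X)"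
  have i: "(1 - fps_X) * i = 1"
    by (simp add: i_def inverse_mult_eq_1')
  have s: "- fps_X / (1 - fps_X) = - (fps_X * i)"
    by (simp add: fps_divide_unit i_def)
  have two: "2 oo a = (2 :: complex fps)" for a
    by (metis fps_compose_1 fps_compose_add_distrib one_add_one)
  \<comment> \<open>The substitution turns 2 - z into 2 + z / (1 - z) = (2 - z) / (1 - z), so the
    factor 1 - z cancels in the quotient.\<close>
  have "(2 + fps_X * i) * (1 - fps_X) = 2 * (1 - fps_X) + fps_X * ((1 - fps_X) * i)"
    by (simp only: algebra_simps)
  also have "\<dots> = 2 - fps_X"
    by (simp add: i)
  finally have e: "2 - fps_X = (2 + fps_X * i) * (1 - fps_X)" ..
  have "inverse (2 - fps_X) = inverse (2 + fps_X * i) * i"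
    unfolding e by (simp add: fps_inverse_mult i_def)
  then show ?thesis
    unfolding s
    by (simp add: fps_divide_compose fps_compose_sub_distrib two) (simp add: fps_divide_unit mult_ac)
qed

lemma fps_even_conv_compose_X_squared:
  fixes H :: "'a :: {idom, ring_char_0} fps"
  assumes "H oo (- fps_X) = H"
  shows "\<exists>\<Phi>. H = \<Phi> oo fps_X ^ 2"
proof
  have odd: "fps_nth H n = 0" if "odd n" for n
  proof -
    have "fps_nth H n = - fps_nth H n"
      using that arg_cong[OF assms, of "\<lambda>f. fps_nth f n"] by (simp add: fps_compose_uminus')
    then show ?thesis
      by (metis add_eq_0_iff2 mult_2 mult_eq_0_iff zero_neq_numeral)
  qed
  show "H = Abs_fps (\<lambda>n. fps_nth H (2 * n)) oo fps_X ^ 2"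
  proof (rule fps_ext)
    fix n
    have "fps_nth (Abs_fps (\<lambda>n. fps_nth H (2 * n)) oo fps_X ^ 2) n
        = (\<Sum>i=0..n. if n = 2 * i then fps_nth H n else 0)"
      unfolding fps_compose_nth by (intro sum.cong) (auto simp flip: power_mult)
    also have "\<dots> = fps_nth H n"
    proof (cases "even n")
      case True
      then obtain m where "n = 2 * m" ..
      then show ?thesis
        by simp
    qed (use odd in \<open>auto intro!: sum.neutral\<close>)
    finally show "fps_nth H n = fps_nth (Abs_fps (\<lambda>n. fps_nth H (2 * n)) oo fps_X ^ 2) n" ..
  qed
qed

lemma mobius_covariant_iff_ex:
  "mobius_covariant \<alpha> F \<longleftrightarrow>
     (\<exists>\<Phi>. F = fps_binomial_minus (\<alpha> / 2) * (\<Phi> oo ((fps_X / (2 - fps_X)) ^ 2)))"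
proof
  let ?u = "fps_X / (2 - fps_X) :: complex fps" and ?m = "- fps_X / (1 - fps_X) :: complex fps"
  have u0: "fps_nth ?u 0 = 0" and m0: "fps_nth ?m 0 = 0"
    by simp_all
  have u1: "fps_nth ?u 1 \<noteq> 0"
    by (simp add: fps_divide_unit)
  have M: "fps_binomial_minus (- \<alpha>) = fps_binomial_minus (- (\<alpha> / 2)) * fps_binomial_minus (- (\<alpha> / 2))"
    by (simp flip: fps_binomial_minus_add)
  have M1: "fps_binomial_minus (- (\<alpha> / 2)) * fps_binomial_minus (\<alpha> / 2) = 1"
    by (simp flip: fps_binomial_minus_add)
  {
    assume "\<exists>\<Phi>. F = fps_binomial_minus (\<alpha> / 2) * (\<Phi> oo (?u ^ 2))"
    then obtain \<Phi> where F: "F = fps_binomial_minus (\<alpha> / 2) * (\<Phi> oo (?u ^ 2))" ..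
    \<comment> \<open>\<open>?m\<close> only changes the sign of \<open>?u\<close>.\<close>
    have "?u ^ 2 oo ?m = ?u ^ 2"
      by (simp only: fps_compose_power[OF m0, symmetric] fps_X_div_two_minus_X_compose_mobius)
         simp
    then have "\<Phi> oo ?u ^ 2 oo ?m = \<Phi> oo ?u ^ 2"
      by (subst fps_compose_assoc [symmetric]) (simp_all add: u0 m0)
    then have "F oo ?m = fps_binomial_minus (- (\<alpha> / 2)) * (\<Phi> oo ?u ^ 2)"
      by (simp add: F fps_compose_mult_distrib m0 fps_binomial_minus_compose_mobius)
    also have "\<dots> = fps_binomial_minus (- \<alpha>) * F"
      using M1 by (simp add: M F mult_ac)
    finally show "mobius_covariant \<alpha> F"
      by (simp add: mobius_covariant_def)
  }
  {
    assume cov: "mobius_covariant \<alpha> F"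
    \<comment> \<open>Removing half of the weight makes \<open>G\<close> invariant under
      \<open>?m\<close>, because \<open>?m\<close> inverts the remaining power of 1 - z.\<close>
    define G where "G = fps_binomial_minus (- (\<alpha> / 2)) * F"
    \<comment> \<open>\<open>?u\<close> has a compositional inverse, its constant term being zero
      and its linear coefficient nonzero, so \<open>G\<close> is a series in
      \<open>?u\<close>.\<close>
    define H where "H = fps_ginv G ?u"
    have G: "G = H oo ?u"
      unfolding H_def by (rule fps_ginv[OF u0 u1, symmetric])
    have "G oo ?m = fps_binomial_minus (\<alpha> / 2) * (fps_binomial_minus (- \<alpha>) * F)"
      using cov by (simp add: G_def fps_compose_mult_distrib m0 fps_binomial_minus_compose_mobius
          mobius_covariant_def)
    also have "\<dots> = G"
      using M1 by (simp add: M G_def mult_ac)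
    finally have "H oo (?u oo ?m) = H oo ?u"
      by (simp add: G fps_compose_assoc u0 m0)
    then have "H oo ((- fps_X) oo ?u) = H oo ?u"
      by (simp add: fps_X_div_two_minus_X_compose_mobius fps_compose_uminus u0)
    then have "H oo (- fps_X) oo ?u = H oo ?u"
      by (simp add: fps_compose_assoc u0)
    \<comment> \<open>Invariance of \<open>G\<close> becomes evenness of \<open>H\<close> once the
      invertible \<open>?u\<close> is cancelled.\<close>
    then have "H oo (- fps_X) = H"
      using fps_compose_inj_right[OF u0 u1] by blast
    then obtain \<Phi> where "H = \<Phi> oo fps_X ^ 2"
      using fps_even_conv_compose_X_squared by blast
    then have "G = \<Phi> oo (fps_X ^ 2 oo ?u)"
      by (simp add: G fps_compose_assoc u0)
    then have "G = \<Phi> oo ?u ^ 2"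
      by (simp add: u0 flip: fps_compose_power)
    moreover have "F = fps_binomial_minus (\<alpha> / 2) * G"
      using M1 by (simp add: G_def mult_ac)
    ultimately show "\<exists>\<Phi>. F = fps_binomial_minus (\<alpha> / 2) * (\<Phi> oo (?u ^ 2))"
      by blast
  }
qed

text \<open>No linear term of \<open>c\<close> is required, so this applies to the square of z / (2
  - z), where cancelling by a compositional inverse is impossible.\<close>

lemma fps_compose_left_inj:
  fixes f g :: "'a :: idom fps"
  assumes "fps_nth c 0 = 0" and "c \<noteq> 0" and "f oo c = g oo c"
  shows "f = g"
  using assms fps_compose_eq_0_iff[of c "f - g"] by (simp add: fps_compose_sub_distrib)

lemma mobius_representation_unique:
  assumes "fps_binomial_minus \<beta> * (\<Phi> oo ((fps_X / (2 - fps_X)) ^ 2))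
         = fps_binomial_minus \<beta> * (\<Psi> oo ((fps_X / (2 - fps_X)) ^ 2))"
  shows "\<Phi> = \<Psi>"
proof (rule fps_compose_left_inj)
  let ?u = "fps_X / (2 - fps_X) :: complex fps"
  have "fps_nth ?u 1 \<noteq> 0"
    by (simp add: fps_divide_unit)
  then show "?u ^ 2 \<noteq> 0"
    by auto
  show "\<Phi> oo ?u ^ 2 = \<Psi> oo ?u ^ 2"
    using assms fps_binomial_minus_neq_0 by simp
qed simp

theorem theorem2p3:
  fixes \<alpha> :: complex and F :: "complex fps"
  shows "(mobius_covariant \<alpha> F \<longleftrightarrow> mobius_coefficient_duality \<alpha> F)
    \<and> (mobius_coefficient_duality \<alpha> F \<longleftrightarrow>
         (\<forall>r::nat. fps_nth F r =
            fps_nth (fps_binomial (of_nat r - 1 - \<alpha>) * (F oo (- fps_X))) r))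
    \<and> ((\<forall>r::nat. fps_nth F r =
            fps_nth (fps_binomial (of_nat r - 1 - \<alpha>) * (F oo (- fps_X))) r) \<longleftrightarrow>
       (\<exists>!\<Phi> :: complex fps.
          F = fps_binomial_minus (\<alpha> / 2) * (\<Phi> oo ((fps_X / (2 - fps_X)) ^ 2))))"
    (is "(?cov \<longleftrightarrow> ?dual) \<and> (?dual \<longleftrightarrow> ?coeff) \<and> (?coeff \<longleftrightarrow> ?repr)")
proof -
  have "?dual" if "?cov"
    using that by (rule mobius_covariant_imp_duality)
  moreover have "?coeff" if "?dual"
  proof
    fix r
    have "mobius_duality_at \<alpha> F r 1"
      using that by (simp add: mobius_coefficient_duality_def)
    then show "fps_nth F r = fps_nth (fps_binomial (of_nat r - 1 - \<alpha>) * (F oo (- fps_X))) r"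
      by (simp add: mobius_duality_at_def)
  qed
  moreover have "?cov" if "?coeff"
    using that by (intro mobius_covariantI_coefficients) blast
  \<comment> \<open>Uniqueness holds for every \<alpha> and F, so unique existence amounts to
    existence.\<close>
  moreover have "?cov \<longleftrightarrow> ?repr"
    unfolding mobius_covariant_iff_ex using mobius_representation_unique by metis
  ultimately show ?thesis
    by blast
qed

end
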